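(* Let $A\subset\mathbb{R}$ be an open invex subset with respect to $\eta:A\times A\to\mathbb{R}$ and let $a,b\in A$ with $a<a+\eta(b,a)$. Suppose that $f:A\to\mathbb{R}$ is a differentiable function, that $|f'|^{q}$ is a preinvex function (with respect to $\eta$) on $[a,a+\eta(b,a)]$ for some fixed $q\ge1$, and that $f'$ is integrable on $[a,a+\eta(b,a)]$. Then $$\left|f\left(\frac{2a+\eta(b,a)}{2}\right)-\frac{1}{\eta(b,a)}\int_{a}^{a+\eta(b,a)}f(u)\,du\right|\le\left(\frac{3^{1-\frac1q}}{8}\right)\eta(b,a)\left(|f'(a)|+|f'(b)|\right).$$
   Context: A set $S\subset\mathbb{R}$ is called invex with respect to $\eta$ if $x+t\eta(y,x)\in S$ for all $x,y\in S$ and $t\in[0,1]$. A function $g$ on an invex set $S$ is called preinvex with respect to $\eta$ if $g(x+t\eta(y,x))\le(1-t)g(x)+t\,g(y)$ for all $x,y\in S$ and $t\in[0,1]$.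
   Formalization: The preinvexity inequality for |f'|^q is assumed for all x, y in [a, a+η(b,a)] together with the point b; if b lies outside that interval, the claim as printed is false because nothing then constrains f'(b). *)

theory Defs
  imports "HOL-Analysis.Analysis"
begin

definition invex :: "(real \<Rightarrow> real \<Rightarrow> real) \<Rightarrow> real set \<Rightarrow> bool" where
  "invex \<eta> S \<longleftrightarrow> (\<forall>x\<in>S. \<forall>y\<in>S. \<forall>t\<in>{0..1}. x + t * \<eta> y x \<in> S)"

(* Invexity is not built in: S may be any subset of the invex domain of g, which already
   contains all the points x + t * \<eta> y x at which g is evaluated. *)
definition preinvex_on :: "(real \<Rightarrow> real \<Rightarrow> real) \<Rightarrow> real set \<Rightarrow> (real \<Rightarrow> real) \<Rightarrow> bool" where
  "preinvex_on \<eta> S g \<longleftrightarrow>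
     (\<forall>x\<in>S. \<forall>y\<in>S. \<forall>t\<in>{0..1}. g (x + t * \<eta> y x) \<le> (1 - t) * g x + t * g y)"

end

theory Submission
  imports Defs
begin

text \<open>Since \<open>x \<mapsto> x powr (1 / q)\<close> is concave, preinvexity bounds \<open>\<bar>f'\<bar>\<close> on the interval by an affine
  function, the tangent taken at the mean \<open>N = (\<bar>f' a\<bar> powr q + \<bar>f' b\<bar> powr q) / 2\<close>. Its value
  at the midpoint \<open>m\<close> is \<open>N powr (1 / q)\<close>. Integrating this bound twice, first to bound \<open>\<bar>f m - f x\<bar>\<close>
  and then over \<open>x\<close>, the slope of the affine function cancels by symmetry and
  \<open>N powr (1 / q) * \<eta> b a / 4\<close> remains for the left-hand side. This is at most the claimed bound,
  even with \<open>2\<close> in place of \<open>3\<close>.\<close>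

text \<open>Young's inequality with weights 1 / q and 1 - 1 / q, applied to \<open>y powr q\<close>
  and the mean, is the tangent inequality for the concave power. The slope \<open>c\<close> depends
  on \<alpha>, \<beta>, \<open>q\<close> but not on \<open>t\<close> or \<open>y\<close>.\<close>

lemma powr_convex_comb_le_affine:
  fixes \<alpha> \<beta> q :: real
  assumes "0 \<le> \<alpha>" "0 \<le> \<beta>" "1 \<le> q"
  obtains c where
    "\<And>t y. \<lbrakk>0 \<le> y; 0 \<le> t; t \<le> 1; y powr q \<le> (1 - t) * \<alpha> + t * \<beta>\<rbrakk> \<Longrightarrow>
       y \<le> ((\<alpha> + \<beta>) / 2) powr (1 / q) + c * (t - 1 / 2)"
proof (cases "\<alpha> + \<beta> = 0")
  case True
  then have "\<alpha> = 0" "\<beta> = 0" using assms by auto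
  then show ?thesis
    by (intro that[of 0]) (auto simp: powr_def split: if_splits)
next
  case False
  define p where "p = 1 / q"
  define N where "N = (\<alpha> + \<beta>) / 2"
  have p: "0 < p" "p \<le> 1" using assms by (auto simp: p_def)
  have N: "0 < N" using False assms by (auto simp: N_def)
  define r where "r = N powr (1 - p)"
  have r: "0 < r" "N powr p * r = N"
    using N by (auto simp: r_def simp flip: powr_add)
  \<comment> \<open>The slope is a chain rule: \<open>p / r\<close> is the derivative of the
    \<open>p\<close>-th power at \<open>N\<close>, and the convex combination has slope \<beta> -
    \<alpha> in \<open>t\<close> and value \<open>N\<close> at \<open>t = 1 / 2\<close>.\<close>
  have "y \<le> N powr p + p * (\<beta> - \<alpha>) / r * (t - 1 / 2)"
    if "0 \<le> y" "0 \<le> t" "t \<le> 1" and y: "y powr q \<le> (1 - t) * \<alpha> + t * \<beta>" for t y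
  \<comment> \<open>Young's inequality is applied to positive numbers; for \<open>y = 0\<close> the
    claim is nonnegativity of the tangent line.\<close>
  proof (cases "y = 0")
    case True
    have "0 \<le> (1 - t) * \<alpha> + t * \<beta>" using assms that by (intro add_nonneg_nonneg mult_nonneg_nonneg) auto
    then have "0 \<le> p * ((1 - t) * \<alpha> + t * \<beta>) + (1 - p) * N" using p N by simp
    also have "\<dots> = (N powr p + p * (\<beta> - \<alpha>) / r * (t - 1 / 2)) * r"
      using r by (simp add: N_def field_simps)
    finally show ?thesis using True r by (simp add: zero_le_mult_iff)
  next
    case False
    have "y * r = (y powr q) powr p * N powr (1 - p)"
      using False that assms by (simp add: r_def p_def powr_powr)
    also have "\<dots> \<le> p * y powr q + (1 - p) * N"
      using p N False that by (intro Youngs_inequality_0) auto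
    also have "\<dots> \<le> p * ((1 - t) * \<alpha> + t * \<beta>) + (1 - p) * N"
      using y p by simp
    also have "\<dots> = (N powr p + p * (\<beta> - \<alpha>) / r * (t - 1 / 2)) * r"
      using r by (simp add: N_def field_simps)
    finally show ?thesis using r by simp
  qed
  then show ?thesis using that unfolding N_def p_def by blast
qed

text \<open>The \<open>q\<close>-th power is superadditive on nonnegative reals: one factor splits
  off, and the remaining power \<open>q - 1\<close> is monotone.\<close>

lemma powr_mean_le:
  fixes x y q :: real
  assumes "0 \<le> x" "0 \<le> y" "1 \<le> q"
  shows "((x powr q + y powr q) / 2) powr (1 / q) \<le> 2 powr (- (1 / q)) * (x + y)"
proof -
  have *: "z powr q = z * z powr (q - 1)" if "0 \<le> z" for z :: real
    using that by (cases "z = 0") (auto simp: powr_mult_base)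
  have "x powr q + y powr q \<le> x * (x + y) powr (q - 1) + y * (x + y) powr (q - 1)"
    using assms by (auto simp: * intro!: add_mono mult_left_mono powr_mono2)
  also have "\<dots> = (x + y) powr q"
    using assms by (simp add: *[of "x + y"] algebra_simps)
  finally have "((x powr q + y powr q) / 2) powr (1 / q) \<le> ((x + y) powr q / 2) powr (1 / q)"
    using assms by (intro powr_mono2) auto
  also have "\<dots> = 2 powr (- (1 / q)) * (x + y)"
    using assms by (auto simp: powr_divide powr_powr powr_minus field_simps)
  finally show ?thesis .
qed

text \<open>The difference is 1 / h times the integral of \<open>f m - f x\<close>, which is
  controlled on each half of the interval by an antiderivative of the bound on
  \<open>f'\<close>.\<close>

lemma midpoint_integral_mean_le:
  fixes f f' :: "real \<Rightarrow> real"
  assumes "0 < h"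
    and der: "\<And>x. x \<in> {a..a + h} \<Longrightarrow> (f has_real_derivative f' x) (at x)"
    and bound: "\<And>x. x \<in> {a..a + h} \<Longrightarrow> \<bar>f' x\<bar> \<le> K + c * (x - (a + h / 2))"
  shows "\<bar>f (a + h / 2) - 1 / h * integral {a..a + h} f\<bar> \<le> K * h / 4"
proof -
  define m where "m = a + h / 2"
  \<comment> \<open>\<open>P\<close> and \<open>Q\<close> are the first and second antiderivatives
    of the bound, normalized to vanish at \<open>m\<close>.\<close>
  define P where "P = (\<lambda>x. K * (x - m) + c * (x - m)\<^sup>2 / 2)"
  define Q where "Q = (\<lambda>x. K * (x - m)\<^sup>2 / 2 + c * (x - m) ^ 3 / 6)"
  have P: "(P has_real_derivative K + c * (x - m)) (at x)" for x
    unfolding P_def by (auto intro!: derivative_eq_intros)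
  have Q: "(Q has_real_derivative P x) (at x within S)" for x S
    unfolding Q_def P_def by (auto intro!: derivative_eq_intros simp: power2_eq_square)
  have dist: "\<bar>f y - f x\<bar> \<le> P y - P x" if "a \<le> x" "x \<le> y" "y \<le> a + h" for x y
  proof -
    have f': "\<bar>f' z\<bar> \<le> K + c * (z - m)" if "x \<le> z" "z \<le> y" for z
      using bound[of z] that \<open>a \<le> x\<close> \<open>y \<le> a + h\<close> by (simp add: m_def)
    have D: "(f has_real_derivative f' z) (at z)" if "x \<le> z" "z \<le> y" for z
      using der[of z] that \<open>a \<le> x\<close> \<open>y \<le> a + h\<close> by simp
    \<comment> \<open>The bound on \<open>f'\<close> makes both \<open>P - f\<close> and
      \<open>P + f\<close> nondecreasing, one for each sign of the increment of
      \<open>f\<close>.\<close>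
    have "P x - f x \<le> P y - f y"
      using f' by (intro DERIV_nonneg_imp_nondecreasing[OF \<open>x \<le> y\<close>] exI conjI)
        (rule DERIV_diff[OF P D], auto simp: abs_le_iff)
    moreover have "P x + f x \<le> P y + f y"
      using f' by (intro DERIV_nonneg_imp_nondecreasing[OF \<open>x \<le> y\<close>] exI conjI)
        (rule DERIV_add[OF P D], force+)
    ultimately show ?thesis by linarith
  qed
  have cont: "continuous_on {a..a + h} f"
    using der by (meson DERIV_isCont continuous_at_imp_continuous_on)
  have int: "(\<lambda>x. f m - f x) integrable_on {u..v}" if "a \<le> u" "v \<le> a + h" for u v
    using that by (intro integrable_continuous_real continuous_intros continuous_on_subset[OF cont]) auto
  have PQ: "(P has_integral Q v - Q u) {u..v}" if "u \<le> v" for u v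
    using that Q by (intro fundamental_theorem_of_calculus)
      (auto simp flip: has_real_derivative_iff_has_vector_derivative)
  have Pm: "P m = 0" "Q m = 0" by (auto simp: P_def Q_def)
  have am: "a \<le> m" "m \<le> a + h" using assms by (auto simp: m_def)
  \<comment> \<open>Left of \<open>m\<close> the increment of \<open>P\<close> up to
    \<open>m\<close> is \<open>- P x\<close>, whose integral is
    \<open>Q a - Q m = Q a\<close>.\<close>
  have "norm (integral {a..m} (\<lambda>x. f m - f x)) \<le> integral {a..m} (\<lambda>x. - P x)"
    using am dist[of _ m] Pm by (intro integral_norm_bound_integral int integrable_neg)
      (auto intro: has_integral_integrable[OF PQ])
  then have 1: "\<bar>integral {a..m} (\<lambda>x. f m - f x)\<bar> \<le> Q a"
    using integral_unique[OF PQ[of a m]] am Pm by simp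
  have "norm (integral {m..a + h} (\<lambda>x. f m - f x)) \<le> integral {m..a + h} P"
    using am dist[of m] Pm by (intro integral_norm_bound_integral int)
      (auto simp: abs_minus_commute intro: has_integral_integrable[OF PQ])
  then have 2: "\<bar>integral {m..a + h} (\<lambda>x. f m - f x)\<bar> \<le> Q (a + h)"
    using integral_unique[OF PQ[of m "a + h"]] am Pm by simp
  have "integral {a..a + h} (\<lambda>x. f m - f x) =
      integral {a..m} (\<lambda>x. f m - f x) + integral {m..a + h} (\<lambda>x. f m - f x)"
    using am int by (simp add: Henstock_Kurzweil_Integration.integral_combine)
  \<comment> \<open>The cubic terms of \<open>Q\<close> are odd about \<open>m\<close> and cancel;
    the quadratic ones are equal and add.\<close>
  moreover have "Q a + Q (a + h) = K * h\<^sup>2 / 4"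
    by (simp add: Q_def m_def power2_eq_square power3_eq_cube field_simps)
  ultimately have "\<bar>integral {a..a + h} (\<lambda>x. f m - f x)\<bar> \<le> K * h\<^sup>2 / 4"
    using 1 2 by linarith
  moreover have "integral {a..a + h} (\<lambda>x. f m - f x) = h * f m - integral {a..a + h} f"
    using integrable_continuous_real[OF cont] assms(1)
    by (subst Henstock_Kurzweil_Integration.integral_diff) auto
  moreover have "f m - 1 / h * integral {a..a + h} f = (h * f m - integral {a..a + h} f) / h"
    using assms(1) by (simp add: field_simps)
  ultimately show ?thesis
    using assms(1) unfolding m_def[symmetric]
    by (simp add: abs_divide field_simps power2_eq_square)
qed

theorem corollary2p9:
  fixes A :: "real set" and \<eta> :: "real \<Rightarrow> real \<Rightarrow> real"
    and f :: "real \<Rightarrow> real" and a b q :: real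
  assumes "open A" and "invex \<eta> A"
    and "a \<in> A" and "b \<in> A" and "a < a + \<eta> b a"
    and "f differentiable_on A"
    and "q \<ge> 1"
    and "preinvex_on \<eta> (insert b {a..a + \<eta> b a}) (\<lambda>x. \<bar>deriv f x\<bar> powr q)"
    and "deriv f absolutely_integrable_on {a..a + \<eta> b a}"
  shows "\<bar>f ((2 * a + \<eta> b a) / 2) - 1 / \<eta> b a * integral {a..a + \<eta> b a} f\<bar>
         \<le> (3 powr (1 - 1 / q) / 8) * \<eta> b a * (\<bar>deriv f a\<bar> + \<bar>deriv f b\<bar>)"
proof -
  define h where "h = \<eta> b a"
  have h: "0 < h" using assms(5) by (simp add: h_def)
  let ?\<alpha> = "\<bar>deriv f a\<bar> powr q" and ?\<beta> = "\<bar>deriv f b\<bar> powr q"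
  define K where "K = ((?\<alpha> + ?\<beta>) / 2) powr (1 / q)"
  obtain c where c: "\<And>t y. \<lbrakk>0 \<le> y; 0 \<le> t; t \<le> 1; y powr q \<le> (1 - t) * ?\<alpha> + t * ?\<beta>\<rbrakk> \<Longrightarrow>
       y \<le> K + c * (t - 1 / 2)"
    using powr_convex_comb_le_affine[of ?\<alpha> ?\<beta> q] assms(7) unfolding K_def by auto
  have param: "\<exists>t\<in>{0..1}. x = a + t * h" if "x \<in> {a..a + h}" for x
    using that h by (intro bexI[of _ "(x - a) / h"]) auto
  have der: "(f has_real_derivative deriv f x) (at x)" if "x \<in> {a..a + h}" for x
  proof -
    have "x \<in> A" using param[OF that] assms(2-4) by (auto simp: invex_def h_def)
    then have "f differentiable (at x)"
      using assms(1,6) by (metis at_within_open differentiable_on_def)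
    then show ?thesis
      using DERIV_deriv_iff_real_differentiable by blast
  qed
  have bound: "\<bar>deriv f x\<bar> \<le> K + (c / h) * (x - (a + h / 2))" if x: "x \<in> {a..a + h}" for x
  proof -
    obtain t where t: "0 \<le> t" "t \<le> 1" "x = a + t * h" using param[OF x] by auto
    \<comment> \<open>This is preinvexity for the pair \<open>a\<close>, \<open>b\<close>; the
      \<open>insert\<close> provides the membership of \<open>b\<close>, which may lie outside the
      interval.\<close>
    have "\<bar>deriv f x\<bar> powr q \<le> (1 - t) * ?\<alpha> + t * ?\<beta>"
      using assms(5,8) t unfolding preinvex_on_def h_def by simp
    then have "\<bar>deriv f x\<bar> \<le> K + c * (t - 1 / 2)" using t by (intro c) auto
    also have "c * (t - 1 / 2) = (c / h) * (x - (a + h / 2))"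
      using h t by (simp add: field_simps)
    finally show ?thesis .
  qed
  have "\<bar>f (a + h / 2) - 1 / h * integral {a..a + h} f\<bar> \<le> K * h / 4"
    by (rule midpoint_integral_mean_le[OF h der bound])
  also have "\<dots> \<le> (2 powr (- (1 / q)) * (\<bar>deriv f a\<bar> + \<bar>deriv f b\<bar>)) * h / 4"
    using h powr_mean_le[of "\<bar>deriv f a\<bar>" "\<bar>deriv f b\<bar>" q] assms(7) by (simp add: K_def)
  also have "\<dots> = (2 powr (1 - 1 / q) / 8) * h * (\<bar>deriv f a\<bar> + \<bar>deriv f b\<bar>)"
    by (simp add: powr_diff powr_minus field_simps)
  \<comment> \<open>The exponent is nonnegative since \<open>q \<ge> 1\<close>, so the base may grow
    from 2 to 3.\<close>
  also have "\<dots> \<le> (3 powr (1 - 1 / q) / 8) * h * (\<bar>deriv f a\<bar> + \<bar>deriv f b\<bar>)"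
    using h assms(7) by (intro mult_right_mono divide_right_mono powr_mono2) auto
  finally show ?thesis by (simp add: h_def add_divide_distrib)
qed

end
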